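(* The price of anarchy, with respect to liquid welfare, of mixed Nash equilibria of simultaneous all-pay auctions with budgets where bidders have XOS valuations is at least $3$. That is, the supremum of $\mathrm{OPT}(I)/\mathrm{LW}(I,A)$ over all such instances $I$ and all mixed Nash equilibria $A$ of $I$ is at least $3$.
   Context: Simultaneous all-pay auction: bidders $N=[n]$, $n\ge2$; items $M=[m]$, $m\ge1$. Bidder $i$ submits $a_i=(a_{ij})_{j\in M}\in\mathcal A_i=\mathbb R_{\ge0}^m$; $\mathcal A=\prod_i\mathcal A_i$. Each item $j$ is awarded to exactly one bidder among those with the highest bid on $j$, ties being resolved by a fixed order over bidders (part of the instance); $X_i(a)\subseteq M$ is the set of items won by $i$, and $i$ pays $P_i(a)=\sum_{j\in M}a_{ij}$ (whether winning or not). Bidder $i$ has a monotone valuation $v_i:2^M\to\mathbb R_{\ge0}$, $v_i(\emptyset)=0$, and a budget $B_i\in(0,\infty]$; $v_i$ is XOS (fractionally subadditive) if there is a class $\mathcal L_i$ of vectors $(v_{ij}^\ell)_{j\in M}\in\mathbb R_{\ge0}^m$ with $v_i(S)=\max_{\ell\in\mathcal L_i}\sum_{j\in S}v_{ij}^\ell$ for all $S\subseteq M$. Utility: $u_i(a)=v_i(X_i(a))-P_i(a)$. The feasible allocations $\mathcal X$ are the profiles $(x_i)_{i\in N}$ of pairwise disjoint subsets of $M$. $\Delta(S)$ denotes probability distributions on $S$. A mixed Nash equilibrium is a product distribution $A=\prod_iA_i$, $A_i\in\Delta(\mathcal A_i)$, such that for all $i$: $\mathbb E_{a\sim A}[P_i(a)]\le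 B_i$, and $\mathbb E_{a\sim A}[u_i(a)]\ge\mathbb E_{a_i'\sim A_i',a_{-i}\sim A_{-i}}[u_i(a_i',a_{-i})]$ for every $A_i'\in\Delta(\mathcal A_i)$ with $\mathbb E_{a_i'\sim A_i',a_{-i}\sim A_{-i}}[P_i(a_i',a_{-i})]\le B_i$. $\mathrm{LW}(I,A)=\sum_i\min\{\mathbb E_{a\sim A}[v_i(X_i(a))],B_i\}$ and $\mathrm{OPT}(I)=\max_{\chi\in\Delta(\mathcal X)}\sum_i\min\{\mathbb E_{x\sim\chi}[v_i(x_i)],B_i\}$. *)

theory Defs
  imports "HOL-Probability.Probability"
begin

text \<open>
  Bidders are \<open>{..<n}\<close> and items are \<open>{..<m}\<close>; the components of an instance are only
  meaningful on these index sets. An infinite budget is the value \<open>\<infinity>\<close> of type \<^typ>\<open>ennreal\<close>.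
  A pair \<open>(i, k)\<close> in the tie-breaking order means that \<open>i\<close> has priority over \<open>k\<close>; the same order
  is used for all items.
\<close>

record auction =
  num_bidders :: nat
  num_items :: nat
  tie_order :: "nat rel"
  valuation :: "nat \<Rightarrow> nat set \<Rightarrow> real"
  budget :: "nat \<Rightarrow> ennreal"

definition bidders :: "auction \<Rightarrow> nat set" where
  "bidders I = {..<num_bidders I}"

definition items :: "auction \<Rightarrow> nat set" where
  "items I = {..<num_items I}"

definition is_auction :: "auction \<Rightarrow> bool" where
  "is_auction I \<longleftrightarrow>
     num_bidders I \<ge> 2 \<and> num_items I \<ge> 1 \<and>
     linear_order_on (bidders I) (tie_order I) \<and>
     (\<forall>i\<in>bidders I.
        valuation I i {} = 0 \<and>
        (\<forall>S\<subseteq>items I. 0 \<le> valuation I i S) \<and>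
        mono_on (Pow (items I)) (valuation I i) \<and>
        0 < budget I i)"

text \<open>The class \<open>L\<close> may be infinite, so the maximum is spelled out as an attained upper bound.\<close>

definition xos :: "nat set \<Rightarrow> (nat set \<Rightarrow> real) \<Rightarrow> bool" where
  "xos M v \<longleftrightarrow>
     (\<exists>L :: (nat \<Rightarrow> real) set.
        (\<forall>w\<in>L. \<forall>j\<in>M. 0 \<le> w j) \<and>
        (\<forall>S\<subseteq>M. (\<exists>w\<in>L. v S = (\<Sum>j\<in>S. w j)) \<and> (\<forall>w\<in>L. (\<Sum>j\<in>S. w j) \<le> v S)))"

definition xos_auction :: "auction \<Rightarrow> bool" where
  "xos_auction I \<longleftrightarrow>
     is_auction I \<and> (\<forall>i\<in>bidders I. xos (items I) (valuation I i))"

text \<open>A bid profile \<open>a\<close> gives the bid \<open>a i j\<close> of bidder \<open>i\<close> on item \<open>j\<close>.\<close>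

definition highest_bidders :: "auction \<Rightarrow> (nat \<Rightarrow> nat \<Rightarrow> real) \<Rightarrow> nat \<Rightarrow> nat set" where
  "highest_bidders I a j = {i\<in>bidders I. \<forall>k\<in>bidders I. a k j \<le> a i j}"

definition won_items :: "auction \<Rightarrow> nat \<Rightarrow> (nat \<Rightarrow> nat \<Rightarrow> real) \<Rightarrow> nat set" where
  "won_items I i a =
     {j\<in>items I. i \<in> highest_bidders I a j \<and> (\<forall>k\<in>highest_bidders I a j. (i, k) \<in> tie_order I)}"

definition payment :: "auction \<Rightarrow> nat \<Rightarrow> (nat \<Rightarrow> nat \<Rightarrow> real) \<Rightarrow> real" where
  "payment I i a = (\<Sum>j\<in>items I. a i j)"

definition utility :: "auction \<Rightarrow> nat \<Rightarrow> (nat \<Rightarrow> nat \<Rightarrow> real) \<Rightarrow> real" where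
  "utility I i a = valuation I i (won_items I i a) - payment I i a"

text \<open>The bid vectors of one bidder: nonnegative real vectors with their Borel sigma-algebra.\<close>

definition bid_space :: "auction \<Rightarrow> (nat \<Rightarrow> real) measure" where
  "bid_space I = Pi\<^sub>M (items I) (\<lambda>_. restrict_space borel {0..})"

definition mixed_strategies :: "auction \<Rightarrow> (nat \<Rightarrow> real) measure set" where
  "mixed_strategies I = {D. prob_space D \<and> sets D = sets (bid_space I)}"

text \<open>A mixed profile is given by its marginals; only those of the bidders matter.\<close>

definition profile_dist ::
    "auction \<Rightarrow> (nat \<Rightarrow> (nat \<Rightarrow> real) measure) \<Rightarrow> (nat \<Rightarrow> nat \<Rightarrow> real) measure" where
  "profile_dist I A = Pi\<^sub>M (bidders I) A"

definition expected_payment :: "auction \<Rightarrow> nat \<Rightarrow> (nat \<Rightarrow> (nat \<Rightarrow> real) measure) \<Rightarrow> ennreal" where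
  "expected_payment I i A = (\<integral>\<^sup>+ a. ennreal (payment I i a) \<partial>profile_dist I A)"

definition expected_value :: "auction \<Rightarrow> nat \<Rightarrow> (nat \<Rightarrow> (nat \<Rightarrow> real) measure) \<Rightarrow> ennreal" where
  "expected_value I i A = (\<integral>\<^sup>+ a. ennreal (valuation I i (won_items I i a)) \<partial>profile_dist I A)"

text \<open>
  With an infinite budget the expected payment may be infinite, and then the expected utility is
  \<open>-\<infinity>\<close>. It is therefore the expectation of the positive part minus that of the negative part
  (\<^const>\<open>ennreal\<close> sends negative reals to 0); the former is at most the value of all items, so
  \<open>\<infinity> - \<infinity>\<close> does not occur.
\<close>

definition expected_utility :: "auction \<Rightarrow> nat \<Rightarrow> (nat \<Rightarrow> (nat \<Rightarrow> real) measure) \<Rightarrow> ereal" where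
  "expected_utility I i A =
     enn2ereal (\<integral>\<^sup>+ a. ennreal (utility I i a) \<partial>profile_dist I A) -
     enn2ereal (\<integral>\<^sup>+ a. ennreal (- utility I i a) \<partial>profile_dist I A)"

definition mixed_nash_equilibrium :: "auction \<Rightarrow> (nat \<Rightarrow> (nat \<Rightarrow> real) measure) \<Rightarrow> bool" where
  "mixed_nash_equilibrium I A \<longleftrightarrow>
     (\<forall>i\<in>bidders I. A i \<in> mixed_strategies I) \<and>
     (\<forall>i\<in>bidders I.
        expected_payment I i A \<le> budget I i \<and>
        (\<forall>D\<in>mixed_strategies I.
           expected_payment I i (A(i := D)) \<le> budget I i \<longrightarrow>
           expected_utility I i (A(i := D)) \<le> expected_utility I i A))"

definition liquid_welfare :: "auction \<Rightarrow> (nat \<Rightarrow> (nat \<Rightarrow> real) measure) \<Rightarrow> ennreal" where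
  "liquid_welfare I A = (\<Sum>i\<in>bidders I. min (expected_value I i A) (budget I i))"

definition feasible_allocations :: "auction \<Rightarrow> (nat \<Rightarrow> nat set) set" where
  "feasible_allocations I =
     {x \<in> bidders I \<rightarrow>\<^sub>E Pow (items I). disjoint_family_on x (bidders I)}"

text \<open>
  There are finitely many feasible allocations, so by compactness the supremum below is a maximum.
\<close>

definition opt_liquid_welfare :: "auction \<Rightarrow> ennreal" where
  "opt_liquid_welfare I =
     (SUP p \<in> {p :: (nat \<Rightarrow> nat set) pmf. set_pmf p \<subseteq> feasible_allocations I}.
        (\<Sum>i\<in>bidders I.
          min (\<integral>\<^sup>+ x. ennreal (valuation I i (x i)) \<partial>measure_pmf p) (budget I i)))"

text \<open>
  Quotients of \<^typ>\<open>ennreal\<close> satisfy \<open>0 / 0 = 0\<close> and \<open>x / 0 = \<infinity>\<close> for \<open>x > 0\<close>. The latter never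
  arises below: if the liquid welfare of an equilibrium were 0, then everybody would bid 0 almost
  surely, and a bidder with a positive value for all items could profitably win them all with
  small bids.
\<close>

definition mixed_price_of_anarchy :: "auction set \<Rightarrow> ennreal" where
  "mixed_price_of_anarchy C =
     (SUP (I, A) \<in> {(I, A). I \<in> C \<and> mixed_nash_equilibrium I A}.
        opt_liquid_welfare I / liquid_welfare I A)"

end

theory Submission
  imports Defs
begin

text \<open>
  One item and two bidders: bidder 0 has value \<open>V\<close> and budget \<open>1/2\<close>, bidder 1 has value 1 and
  budget 1. In equilibrium bidder 0 bids uniformly on \<open>[0, 1]\<close>, while bidder 1 bids 0 with
  probability \<open>1 - 1/V\<close> and uniformly on \<open>[0, 1]\<close> otherwise; every bid in \<open>[0, 1]\<close> is then a best
  response, and bidder 0 exhausts the budget exactly. Bidder 1 wins with probability only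
  \<open>1/(2V)\<close>, so the liquid welfare is \<open>1/2 + 1/(2V)\<close>. Giving the item to bidder 0 with probability
  \<open>1/(2V)\<close> already uses up that bidder's cap, so the optimum is at least \<open>3/2 - 1/(2V)\<close>, and the
  ratio tends to 3 as \<open>V\<close> grows.
\<close>

text \<open>Keeps the budget 1/2 as the image of a real number, so that it can be compared and added
  there.\<close>

declare ennreal_half [simp del]

section \<open>Extended nonnegative reals and integrals of differences\<close>

lemma divide_mono_ennreal:
  fixes a b c d :: ennreal
  assumes "a \<le> b" "c \<le> d"
  shows "a / d \<le> b / c"
proof -
  have "inverse d \<le> inverse c"
    using assms(2) by (simp add: less_eq_ennreal.rep_eq inverse_ennreal.rep_eq ereal_inverse_antimono)
  with assms(1) show ?thesis
    unfolding divide_ennreal_def by (intro mult_mono) auto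
qed

text \<open>The positive part of \<open>f - g\<close> plus \<open>g\<close> and the positive part of
  \<open>g - f\<close> plus \<open>f\<close> are both the maximum of \<open>f\<close> and
  \<open>g\<close>. Integrating and rearranging gives the claim; finiteness is what permits the
  subtraction. It turns expected utility into expected value minus expected payment.\<close>

lemma enn2ereal_nn_integral_diff:
  fixes f g :: "'a \<Rightarrow> real"
  assumes [measurable]: "f \<in> borel_measurable M" "g \<in> borel_measurable M"
    and nonneg: "AE x in M. 0 \<le> f x" "AE x in M. 0 \<le> g x"
    and fin: "(\<integral>\<^sup>+x. ennreal (f x) \<partial>M) < \<infinity>" "(\<integral>\<^sup>+x. ennreal (g x) \<partial>M) < \<infinity>"
  shows "enn2ereal (\<integral>\<^sup>+x. ennreal (f x - g x) \<partial>M) - enn2ereal (\<integral>\<^sup>+x. ennreal (g x - f x) \<partial>M)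
       = enn2ereal (\<integral>\<^sup>+x. ennreal (f x) \<partial>M) - enn2ereal (\<integral>\<^sup>+x. ennreal (g x) \<partial>M)"
proof -
  let ?I = "\<lambda>h. \<integral>\<^sup>+x. ennreal (h x) \<partial>M"
  have "?I (\<lambda>x. f x - g x) + ?I g = (\<integral>\<^sup>+x. ennreal (f x - g x) + ennreal (g x) \<partial>M)"
    by (simp add: nn_integral_add)
  also have "\<dots> = (\<integral>\<^sup>+x. ennreal (g x - f x) + ennreal (f x) \<partial>M)"
  proof (rule nn_integral_cong_AE)
    show "AE x in M. ennreal (f x - g x) + ennreal (g x) = ennreal (g x - f x) + ennreal (f x)"
      using nonneg
    proof eventually_elim
      case (elim x)
      then show ?case
        by (cases "f x \<le> g x") (simp_all add: ennreal_neg flip: ennreal_plus)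
    qed
  qed
  also have "\<dots> = ?I (\<lambda>x. g x - f x) + ?I f"
    by (simp add: nn_integral_add)
  finally have eq: "?I (\<lambda>x. f x - g x) + ?I g = ?I (\<lambda>x. g x - f x) + ?I f" .
  have "?I (\<lambda>x. f x - g x) \<le> ?I f" "?I (\<lambda>x. g x - f x) \<le> ?I g"
    using nonneg by (auto intro!: nn_integral_mono_AE ennreal_leI)
  with fin have "?I (\<lambda>x. f x - g x) < \<infinity>" "?I (\<lambda>x. g x - f x) < \<infinity>"
    by (auto intro: le_less_trans)
  with eq fin show ?thesis
    by (cases "?I (\<lambda>x. f x - g x)"; cases "?I (\<lambda>x. g x - f x)"; cases "?I f"; cases "?I g")
       (auto simp flip: ennreal_plus)
qed

section \<open>The two-bidder instance and its expectations\<close>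

text \<open>Ties go to bidder 0, so a bid of 0 already wins against a zero bid of the opponent. This
  makes 0 as good for bidder 0 as any other bid in [0, 1].\<close>

definition duel :: "real \<Rightarrow> auction" where
  "duel V = \<lparr>num_bidders = 2, num_items = 1, tie_order = {(0, 0), (0, 1), (1, 1)},
     valuation = (\<lambda>i S. if 0 \<in> S then if i = 0 then V else 1 else 0),
     budget = (\<lambda>i. if i = 0 then ennreal (1/2) else 1)\<rparr>"

lemma bidders_duel [simp]: "bidders (duel V) = {0, 1}"
  by (auto simp: bidders_def duel_def)

lemma items_duel [simp]: "items (duel V) = {0}"
  by (auto simp: items_def duel_def)

lemma xos_auction_duel:
  assumes "V \<ge> 1"
  shows "xos_auction (duel V)"
proof -
  have "is_auction (duel V)"
    using assms unfolding is_auction_def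
    by (auto simp: duel_def mono_on_def linear_order_on_def partial_order_on_def preorder_on_def
        refl_on_def trans_def antisym_def total_on_def bidders_def items_def)
  moreover have "xos {0} (valuation (duel V) i)" for i
    unfolding xos_def
  \<comment> \<open>With a single item the valuation is additive, so one vector supports it.\<close>
  proof (intro exI[of _ "{\<lambda>_. if i = 0 then V else 1}"] conjI)
    show "\<forall>S\<subseteq>{0}.
        (\<exists>w\<in>{\<lambda>_. if i = 0 then V else 1}. valuation (duel V) i S = (\<Sum>j\<in>S. w j)) \<and>
        (\<forall>w\<in>{\<lambda>_. if i = 0 then V else 1}. (\<Sum>j\<in>S. w j) \<le> valuation (duel V) i S)"
      by (auto simp: duel_def subset_singleton_iff)
  qed (use assms in auto)
  ultimately show ?thesis
    by (simp add: xos_auction_def)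
qed

lemma payment_duel [simp]: "payment (duel V) i a = a i 0"
  by (simp add: payment_def)

lemma valuation_won_items_duel_0 [simp]:
  "valuation (duel V) 0 (won_items (duel V) 0 a) = (if a 1 0 \<le> a 0 0 then V else 0)"
  unfolding won_items_def highest_bidders_def bidders_duel items_duel by (auto simp: duel_def)

lemma valuation_won_items_duel_1 [simp]:
  "valuation (duel V) (Suc 0) (won_items (duel V) (Suc 0) a) = (if a 0 0 < a 1 0 then 1 else 0)"
  unfolding won_items_def highest_bidders_def bidders_duel items_duel by (auto simp: duel_def)

lemma mixed_strategies_duelD:
  assumes "D \<in> mixed_strategies (duel V)"
  shows "prob_space D"
    and "(\<lambda>b. b 0) \<in> borel_measurable D"
    and "\<And>b. b \<in> space D \<Longrightarrow> 0 \<le> b 0"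
proof -
  have sets: "sets D = sets (Pi\<^sub>M {0::nat} (\<lambda>_. restrict_space borel {0::real..}))"
    using assms by (simp add: mixed_strategies_def bid_space_def)
  show "prob_space D"
    using assms by (simp add: mixed_strategies_def)
  have "(\<lambda>b. b 0) \<in> measurable (Pi\<^sub>M {0::nat} (\<lambda>_. restrict_space borel {0::real..}))
      (restrict_space borel {0..})"
    by (rule measurable_component_singleton) simp
  then show "(\<lambda>b. b 0) \<in> borel_measurable D"
    by (simp add: measurable_restrict_space2_iff measurable_cong_sets[OF sets refl])
  show "0 \<le> b 0" if "b \<in> space D" for b
    using that sets_eq_imp_space_eq[OF sets]
    by (auto simp: space_PiM space_restrict_space PiE_iff)
qed

text \<open>Tonelli in both orders: each bidder's win probability is computed with that bidder's own
  bid fixed, so the opponent has to be integrated first. The assumption covers every index because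
  \<open>product_sigma_finite\<close> does.\<close>

lemma nn_integral_profile_dist_duel:
  assumes A: "\<And>i. A i \<in> mixed_strategies (duel V)"
    and f [measurable]: "case_prod f \<in> borel_measurable (borel \<Otimes>\<^sub>M borel)"
  shows "(\<integral>\<^sup>+a. f (a 0 0) (a 1 0) \<partial>profile_dist (duel V) A)
       = (\<integral>\<^sup>+b. \<integral>\<^sup>+c. f (b 0) (c 0) \<partial>A 1 \<partial>A 0)"
    and "(\<integral>\<^sup>+a. f (a 0 0) (a 1 0) \<partial>profile_dist (duel V) A)
       = (\<integral>\<^sup>+c. \<integral>\<^sup>+b. f (b 0) (c 0) \<partial>A 0 \<partial>A 1)"
proof -
  interpret prob_space "A k" for k
    using A by (rule mixed_strategies_duelD)
  have A1: "sigma_finite_measure (A 1)"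
    by unfold_locales
  interpret product_sigma_finite A
    by unfold_locales
  interpret pair_sigma_finite "A 0" "A 1"
    by unfold_locales
  have [measurable]: "(\<lambda>b. b 0) \<in> borel_measurable (A i)" for i
    using A by (rule mixed_strategies_duelD)
  have *: "(\<lambda>(b, c). f (b 0) (c 0)) \<in> borel_measurable (A 0 \<Otimes>\<^sub>M A 1)"
    by measurable
  have "(\<integral>\<^sup>+a. f (a 0 0) (a 1 0) \<partial>profile_dist (duel V) A)
      = (\<integral>\<^sup>+z. f (fst z 0) (snd z 0) \<partial>(A 0 \<Otimes>\<^sub>M A 1))"
    using product_nn_integral_pair[OF *] by (simp add: profile_dist_def)
  then show "(\<integral>\<^sup>+a. f (a 0 0) (a 1 0) \<partial>profile_dist (duel V) A)
       = (\<integral>\<^sup>+b. \<integral>\<^sup>+c. f (b 0) (c 0) \<partial>A 1 \<partial>A 0)"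
    and "(\<integral>\<^sup>+a. f (a 0 0) (a 1 0) \<partial>profile_dist (duel V) A)
       = (\<integral>\<^sup>+c. \<integral>\<^sup>+b. f (b 0) (c 0) \<partial>A 0 \<partial>A 1)"
    using sigma_finite_measure.nn_integral_fst[OF A1 *] nn_integral_snd[OF *] by (simp_all add: split_beta')
qed

lemma expected_value_duel_0:
  assumes "\<And>i. A i \<in> mixed_strategies (duel V)"
  shows "expected_value (duel V) 0 A
    = (\<integral>\<^sup>+b. \<integral>\<^sup>+c. ennreal (if c 0 \<le> b 0 then V else 0) \<partial>A 1 \<partial>A 0)"
  unfolding expected_value_def valuation_won_items_duel_0
  using nn_integral_profile_dist_duel(1)[OF assms, of "\<lambda>x y. ennreal (if y \<le> x then V else 0)"]
  by simp

lemma expected_value_duel_1: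
  assumes "\<And>i. A i \<in> mixed_strategies (duel V)"
  shows "expected_value (duel V) (Suc 0) A
    = (\<integral>\<^sup>+c. \<integral>\<^sup>+b. ennreal (if b 0 < c 0 then 1 else 0) \<partial>A 0 \<partial>A 1)"
  unfolding expected_value_def valuation_won_items_duel_1
  using nn_integral_profile_dist_duel(2)[OF assms, of "\<lambda>x y. ennreal (if x < y then 1 else 0)"]
  by simp

lemma expected_payment_duel:
  assumes "\<And>i. A i \<in> mixed_strategies (duel V)" and "i \<in> {0, 1}"
  shows "expected_payment (duel V) i A = (\<integral>\<^sup>+b. ennreal (b 0) \<partial>A i)"
proof -
  interpret prob_space "A k" for k
    using assms(1) by (rule mixed_strategies_duelD)
  show ?thesis
    using assms(2) nn_integral_profile_dist_duel(1)[OF assms(1), of "\<lambda>x y. ennreal x"]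
      nn_integral_profile_dist_duel(2)[OF assms(1), of "\<lambda>x y. ennreal y"]
    by (auto simp: expected_payment_def emeasure_space_1)
qed

text \<open>The value is bounded by \<open>V\<close>, so finite expected payment is all that
  splitting the utility requires.\<close>

lemma expected_utility_duel:
  assumes A: "\<And>i. A i \<in> mixed_strategies (duel V)" and i: "i \<in> {0, 1}" and "V \<ge> 1"
    and fin: "expected_payment (duel V) i A < \<infinity>"
  shows "expected_utility (duel V) i A
    = enn2ereal (expected_value (duel V) i A) - enn2ereal (expected_payment (duel V) i A)"
proof -
  let ?M = "profile_dist (duel V) A"
  let ?v = "\<lambda>a. valuation (duel V) i (won_items (duel V) i a)"
  interpret prob_space "A k" for k
    using A by (rule mixed_strategies_duelD)
  have P: "prob_space ?M"
    unfolding profile_dist_def by (rule prob_space_PiM) unfold_locales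
  have [measurable]: "(\<lambda>a. a k 0) \<in> borel_measurable ?M" if "k \<in> {0, 1}" for k
    unfolding profile_dist_def bidders_duel
    by (rule measurable_compose[OF measurable_component_singleton[OF that]])
       (rule mixed_strategies_duelD(2)[OF A])
  have [measurable]: "(\<lambda>a. a 0 0) \<in> borel_measurable ?M" "(\<lambda>a. a 1 0) \<in> borel_measurable ?M"
    "(\<lambda>a. a (Suc 0) 0) \<in> borel_measurable ?M"
    by simp_all
  have v [measurable]: "?v \<in> borel_measurable ?M"
    using i by auto
  have v_bounds: "0 \<le> ?v a" "?v a \<le> V" for a
    using i \<open>V \<ge> 1\<close> by auto
  have "(\<integral>\<^sup>+a. ennreal (?v a) \<partial>?M) \<le> (\<integral>\<^sup>+a. ennreal V \<partial>?M)"
    using v_bounds by (intro nn_integral_mono ennreal_leI) auto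
  also have "\<dots> < \<infinity>"
    by (simp add: prob_space.emeasure_space_1[OF P])
  finally have "(\<integral>\<^sup>+a. ennreal (?v a) \<partial>?M) < \<infinity>" .
  moreover have "AE a in ?M. 0 \<le> a i 0"
  proof (rule AE_I2)
    fix a assume "a \<in> space ?M"
    then have "a i \<in> space (A i)"
      unfolding profile_dist_def space_PiM bidders_duel by (rule PiE_mem) (rule i)
    then show "0 \<le> a i 0"
      by (rule mixed_strategies_duelD[OF A])
  qed
  moreover have "(\<lambda>a. a i 0) \<in> borel_measurable ?M"
    using i by auto
  ultimately show ?thesis
    using enn2ereal_nn_integral_diff[OF v, of "\<lambda>a. a i 0"] v_bounds fin
    by (simp add: expected_utility_def utility_def expected_value_def expected_payment_def)
qed

section \<open>Bidding strategies and their integrals\<close>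

text \<open>
  The quantile function of the bid that is 0 with probability \<open>1 - 1/k\<close> and uniform on \<open>[0, 1]\<close>
  otherwise.
\<close>

definition ramp :: "real \<Rightarrow> real \<Rightarrow> real" where
  "ramp k u = max 0 (k * (u - 1) + 1)"

lemma borel_measurable_ramp [measurable]: "ramp k \<in> borel_measurable borel"
  unfolding ramp_def by measurable

definition unif :: "real measure" where
  "unif = uniform_measure lborel {0..1}"

lemma nn_integral_unif:
  assumes [measurable]: "f \<in> borel_measurable borel"
  shows "(\<integral>\<^sup>+u. f u \<partial>unif) = (\<integral>\<^sup>+u. f u * indicator {0..1} u \<partial>lborel)"
  unfolding unif_def by (subst nn_integral_uniform_measure) (simp_all add: divide_ennreal_def)

lemma sets_unif [measurable_cong]: "sets unif = sets borel"
  by (simp add: unif_def)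

text \<open>As a pushforward of the uniform distribution, the strategy reduces every expectation to
  a Lebesgue integral over [0, 1], with or without an atom at 0. For \<open>k = 1\<close> the
  quantile function is the identity on [0, 1].\<close>

definition ramp_strategy :: "real \<Rightarrow> (nat \<Rightarrow> real) measure" where
  "ramp_strategy k =
     distr unif (Pi\<^sub>M {0} (\<lambda>_. restrict_space borel {0..})) (\<lambda>u. \<lambda>j\<in>{0}. ramp k u)"

lemma measurable_ramp_bid:
  "(\<lambda>u. \<lambda>j\<in>{0}. ramp k u) \<in> measurable unif (Pi\<^sub>M {0::nat} (\<lambda>_. restrict_space borel {0..}))"
  by (intro measurable_restrict measurable_restrict_space2) (auto simp: ramp_def)

lemma ramp_strategy_mixed: "ramp_strategy k \<in> mixed_strategies (duel V)"
proof -
  interpret prob_space unif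
    unfolding unif_def by (rule prob_space_uniform_measure) auto
  show ?thesis
    by (auto simp: mixed_strategies_def bid_space_def ramp_strategy_def
        intro!: prob_space_distr measurable_ramp_bid)
qed

lemma nn_integral_ramp_strategy:
  assumes [measurable]: "f \<in> borel_measurable borel"
  shows "(\<integral>\<^sup>+b. f (b 0) \<partial>ramp_strategy k)
    = (\<integral>\<^sup>+u. f (ramp k u) * indicator {0..1} u \<partial>lborel)"
proof -
  have [measurable]: "(\<lambda>b. b 0) \<in> borel_measurable (Pi\<^sub>M {0::nat} (\<lambda>_. restrict_space borel {0::real..}))"
    using mixed_strategies_duelD(2)[OF ramp_strategy_mixed]
    by (simp add: ramp_strategy_def)
  have "(\<integral>\<^sup>+b. f (b 0) \<partial>ramp_strategy k) = (\<integral>\<^sup>+u. f (ramp k u) \<partial>unif)"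
    unfolding ramp_strategy_def by (subst nn_integral_distr[OF measurable_ramp_bid]) simp_all
  then show ?thesis
    by (simp add: nn_integral_unif)
qed

text \<open>The integral is the area of a triangle with base [1 - 1/k, 1] and height 1.\<close>

lemma nn_integral_ramp:
  assumes "k \<ge> 1"
  shows "(\<integral>\<^sup>+b. ennreal (b 0) \<partial>ramp_strategy k) = ennreal (1 / (2 * k))"
proof -
  let ?F = "\<lambda>u. k * (u - 1)\<^sup>2 / 2 + u"
  have support: "1 - 1 / k \<le> u \<longleftrightarrow> 0 \<le> k * (u - 1) + 1" for u
    using assms by (simp add: field_simps)
  have pos: "0 \<le> u" if "1 - 1 / k \<le> u" for u
    using that assms by (intro order_trans[OF _ that]) simp
  have *: "ennreal (ramp k u) * indicator {0..1} u
      = ennreal (k * (u - 1) + 1) * indicator {1 - 1 / k..1} u" for u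
    using pos[of u] support[of u]
    by (cases "1 - 1 / k \<le> u") (auto simp: ramp_def indicator_def max_def)
  have "(\<integral>\<^sup>+b. ennreal (b 0) \<partial>ramp_strategy k)
      = (\<integral>\<^sup>+u. ennreal (k * (u - 1) + 1) * indicator {1 - 1 / k..1} u \<partial>lborel)"
    by (subst nn_integral_ramp_strategy) (simp_all add: *)
  also have "\<dots> = ennreal (?F 1 - ?F (1 - 1 / k))"
    using assms
    by (intro nn_integral_FTC_Icc)
       (auto intro!: derivative_eq_intros simp: field_simps)
  also have "?F 1 - ?F (1 - 1 / k) = 1 / (2 * k)"
    using assms by (simp add: field_simps power2_eq_square)
  finally show ?thesis .
qed

text \<open>Against this strategy a bid x in [0, 1] wins with probability 1 - (1 - x)/k. A prize
  worth exactly \<open>k\<close> turns this into a gain of slope 1 in x, which the payment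
  cancels.\<close>

lemma nn_integral_ramp_le:
  assumes "k \<ge> 1" "x \<ge> 0"
  shows "(\<integral>\<^sup>+b. ennreal (if b 0 \<le> x then k else 0) \<partial>ramp_strategy k) = ennreal (min k (k - 1 + x))"
proof -
  \<comment> \<open>The point where the ramp reaches \<open>x\<close>, capped at 1 for bids above
    1.\<close>
  let ?t = "min 1 (1 - (1 - x) / k)"
  have t: "0 \<le> ?t"
    using assms by (simp add: field_simps)
  have "(\<integral>\<^sup>+b. ennreal (if b 0 \<le> x then k else 0) \<partial>ramp_strategy k)
      = (\<integral>\<^sup>+u. ennreal k * indicator {0..?t} u \<partial>lborel)"
    using assms
    by (subst nn_integral_ramp_strategy)
       (auto intro!: nn_integral_cong simp: ramp_def indicator_def field_simps)
  also have "\<dots> = ennreal k * ennreal ?t"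
    using t by (subst nn_integral_cmult_indicator) auto
  also have "\<dots> = ennreal (min k (k - 1 + x))"
    using assms t by (auto simp: min_def field_simps simp flip: ennreal_mult)
  finally show ?thesis .
qed

text \<open>Bidder 1 loses ties, hence the strict inequality. The uniform bid has no atoms, so the
  value agrees with the weak case; the half-open interval gives the lower bound.\<close>

lemma nn_integral_ramp_less:
  assumes "x \<ge> 0"
  shows "(\<integral>\<^sup>+b. ennreal (if b 0 < x then 1 else 0) \<partial>ramp_strategy 1) = ennreal (min 1 x)"
proof (rule antisym)
  have "(\<integral>\<^sup>+b. ennreal (if b 0 < x then 1 else 0) \<partial>ramp_strategy 1)
      \<le> (\<integral>\<^sup>+b. ennreal (if b 0 \<le> x then 1 else 0) \<partial>ramp_strategy 1)"
    by (rule nn_integral_mono) simp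
  then show "(\<integral>\<^sup>+b. ennreal (if b 0 < x then 1 else 0) \<partial>ramp_strategy 1) \<le> ennreal (min 1 x)"
    using nn_integral_ramp_le[of 1 x] assms by simp
  have "ennreal (min 1 x) = (\<integral>\<^sup>+u. indicator {0..<min 1 x} u \<partial>lborel)"
    using assms by simp
  also have "\<dots> \<le> (\<integral>\<^sup>+u. ennreal (if ramp 1 u < x then 1 else 0) * indicator {0..1} u \<partial>lborel)"
    by (auto intro!: nn_integral_mono simp: ramp_def indicator_def)
  also have "\<dots> = (\<integral>\<^sup>+b. ennreal (if b 0 < x then 1 else 0) \<partial>ramp_strategy 1)"
    by (rule nn_integral_ramp_strategy[symmetric]) simp
  finally show "ennreal (min 1 x) \<le> \<dots>" .
qed

lemma ramp_strategy_le_1: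
  assumes "k \<ge> 1"
  shows "AE b in ramp_strategy k. b 0 \<le> 1"
proof -
  have [measurable]: "(\<lambda>b. b 0) \<in> borel_measurable (ramp_strategy k)"
    by (rule mixed_strategies_duelD(2)[OF ramp_strategy_mixed])
  have "(\<integral>\<^sup>+b. indicator {1<..} (b 0) \<partial>ramp_strategy k)
      = (\<integral>\<^sup>+u. indicator {1<..} (ramp k u) * indicator {0..1} u \<partial>lborel)"
    by (rule nn_integral_ramp_strategy) simp
  also have "\<dots> = (\<integral>\<^sup>+u. 0 \<partial>(lborel :: real measure))"
    using assms by (intro nn_integral_cong) (auto simp: ramp_def indicator_def less_max_iff_disj zero_less_mult_iff)
  finally have "AE b in ramp_strategy k. indicator {1<..} (b 0) = (0::ennreal)"
    by (intro iffD1[OF nn_integral_0_iff_AE]) simp_all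
  then show ?thesis
    by eventually_elim (auto simp: indicator_def split: if_splits)
qed

section \<open>The equilibrium\<close>

text \<open>Each parameter is the opponent's value for the item: \<open>V\<close> in bidder 1's
  strategy makes bidder 0 indifferent on [0, 1], and 1 in bidder 0's strategy does so for bidder
  1.\<close>

definition duel_profile :: "real \<Rightarrow> nat \<Rightarrow> (nat \<Rightarrow> real) measure" where
  "duel_profile V i = ramp_strategy (if i = 0 then 1 else V)"

lemma duel_profile_mixed: "duel_profile V i \<in> mixed_strategies (duel V)"
  by (simp add: duel_profile_def ramp_strategy_mixed)

lemma duel_profile_upd_mixed:
  "D \<in> mixed_strategies (duel V) \<Longrightarrow> ((duel_profile V)(i := D)) k \<in> mixed_strategies (duel V)"
  by (simp add: duel_profile_mixed)

lemma expected_value_duel_profile_0: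
  assumes "V \<ge> 1" and D: "D \<in> mixed_strategies (duel V)"
  shows "expected_value (duel V) 0 ((duel_profile V)(0 := D)) = (\<integral>\<^sup>+b. ennreal (min V (V - 1 + b 0)) \<partial>D)"
  using assms mixed_strategies_duelD(3)[OF D]
  by (subst expected_value_duel_0[OF duel_profile_upd_mixed[OF D]])
     (auto simp: duel_profile_def nn_integral_ramp_le intro!: nn_integral_cong)

lemma expected_value_duel_profile_1:
  assumes D: "D \<in> mixed_strategies (duel V)"
  shows "expected_value (duel V) (Suc 0) ((duel_profile V)(Suc 0 := D)) = (\<integral>\<^sup>+b. ennreal (min 1 (b 0)) \<partial>D)"
  using assms mixed_strategies_duelD(3)[OF D]
  by (subst expected_value_duel_1[OF duel_profile_upd_mixed[OF D]])
     (auto simp: duel_profile_def nn_integral_ramp_less intro!: nn_integral_cong)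

text \<open>The core of the equilibrium argument: \<open>c\<close> is the payoff of bidding 0, and
  no strategy earns more than \<open>c\<close> beyond its payment. Bids above 1 only waste money, so
  equality holds when there are almost surely none.\<close>

lemma expected_value_duel_profile:
  assumes "V \<ge> 1" and D: "D \<in> mixed_strategies (duel V)" and i: "i \<in> {0, 1}"
    and c: "c = (if i = 0 then V - 1 else 0)"
  shows "expected_value (duel V) i ((duel_profile V)(i := D)) \<le> ennreal c + (\<integral>\<^sup>+b. ennreal (b 0) \<partial>D)"
    and "(AE b in D. b 0 \<le> 1) \<Longrightarrow>
      expected_value (duel V) i ((duel_profile V)(i := D)) = ennreal c + (\<integral>\<^sup>+b. ennreal (b 0) \<partial>D)"
proof -
  interpret prob_space D
    using D by (rule mixed_strategies_duelD)
  have [measurable]: "(\<lambda>b. b 0) \<in> borel_measurable D"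
    using D by (rule mixed_strategies_duelD)
  \<comment> \<open>The prize is \<open>c + 1\<close> for both bidders, which lets one formula treat
    both.\<close>
  have eq: "expected_value (duel V) i ((duel_profile V)(i := D))
      = (\<integral>\<^sup>+b. ennreal (min (c + 1) (c + b 0)) \<partial>D)"
    using i c expected_value_duel_profile_0[OF assms(1) D] expected_value_duel_profile_1[OF D]
    by auto
  have c0: "c \<ge> 0"
    using c \<open>V \<ge> 1\<close> by auto
  have add: "(\<integral>\<^sup>+b. ennreal (c + b 0) \<partial>D) = ennreal c + (\<integral>\<^sup>+b. ennreal (b 0) \<partial>D)"
  proof -
    have "(\<integral>\<^sup>+b. ennreal (c + b 0) \<partial>D) = (\<integral>\<^sup>+b. ennreal c + ennreal (b 0) \<partial>D)"
      using c0 mixed_strategies_duelD(3)[OF D] by (intro nn_integral_cong) simp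
    then show ?thesis
      by (simp add: nn_integral_add emeasure_space_1)
  qed
  show "expected_value (duel V) i ((duel_profile V)(i := D)) \<le> ennreal c + (\<integral>\<^sup>+b. ennreal (b 0) \<partial>D)"
    unfolding eq add[symmetric] by (intro nn_integral_mono ennreal_leI) simp
  assume "AE b in D. b 0 \<le> 1"
  then show "expected_value (duel V) i ((duel_profile V)(i := D)) = ennreal c + (\<integral>\<^sup>+b. ennreal (b 0) \<partial>D)"
    unfolding eq add[symmetric] by (intro nn_integral_cong_AE) auto
qed

lemma expected_payment_duel_profile:
  assumes "V \<ge> 1"
  shows "expected_payment (duel V) 0 (duel_profile V) = ennreal (1 / 2)"
    and "expected_payment (duel V) (Suc 0) (duel_profile V) = ennreal (1 / (2 * V))"
  using assms by (simp_all add: expected_payment_duel[OF duel_profile_mixed] duel_profile_def nn_integral_ramp)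

text \<open>The profile gives bidder \<open>i\<close> utility exactly \<open>c\<close>, and a
  deviation gives at most \<open>c\<close>. The budgets are finite, so they bound the payments as
  the utility formula requires.\<close>

lemma duel_profile_equilibrium:
  assumes V: "V \<ge> 1"
  shows "mixed_nash_equilibrium (duel V) (duel_profile V)"
  unfolding mixed_nash_equilibrium_def
proof (intro conjI ballI impI)
  fix i assume "i \<in> bidders (duel V)"
  then have i: "i \<in> {0, 1}" by simp
  define c where "c = (if i = 0 then V - 1 else 0)"
  show pay: "expected_payment (duel V) i (duel_profile V) \<le> budget (duel V) i"
    using i V expected_payment_duel_profile[OF V]
    by (auto simp: duel_def simp flip: ennreal_1 intro!: ennreal_leI)
  have fin: "budget (duel V) i < \<infinity>"
    by (simp add: duel_def)
  fix D assume D: "D \<in> mixed_strategies (duel V)"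
    and "expected_payment (duel V) i ((duel_profile V)(i := D)) \<le> budget (duel V) i"
  then have fin': "expected_payment (duel V) i ((duel_profile V)(i := D)) < \<infinity>"
    using fin by (auto intro: le_less_trans)
  have fin'': "expected_payment (duel V) i (duel_profile V) < \<infinity>"
    using pay fin by (auto intro: le_less_trans)
  \<comment> \<open>Viewing the profile as a trivial deviation from itself makes the lemmas on
    deviations apply to it.\<close>
  have upd: "(duel_profile V)(i := duel_profile V i) = duel_profile V"
    by simp
  have "AE b in duel_profile V i. b 0 \<le> 1"
    unfolding duel_profile_def using V by (intro ramp_strategy_le_1) simp
  then have "expected_value (duel V) i (duel_profile V)
      = ennreal c + expected_payment (duel V) i (duel_profile V)"
    using expected_value_duel_profile(2)[OF V duel_profile_mixed[of V i] i c_def]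
    by (simp add: upd expected_payment_duel[OF duel_profile_mixed i])
  moreover have "expected_value (duel V) i ((duel_profile V)(i := D))
      \<le> ennreal c + expected_payment (duel V) i ((duel_profile V)(i := D))"
    using expected_value_duel_profile(1)[OF V D i c_def]
    by (simp add: expected_payment_duel[OF duel_profile_upd_mixed[OF D] i])
  ultimately show "expected_utility (duel V) i ((duel_profile V)(i := D))
      \<le> expected_utility (duel V) i (duel_profile V)"
    unfolding expected_utility_duel[OF duel_profile_upd_mixed[OF D] i V fin']
      expected_utility_duel[OF duel_profile_mixed i V fin'']
    using fin' fin'' V
    by (cases "expected_payment (duel V) i ((duel_profile V)(i := D))";
        cases "expected_payment (duel V) i (duel_profile V)";
        cases "expected_value (duel V) i ((duel_profile V)(i := D))")
       (auto simp: c_def top_unique simp flip: ennreal_plus split: if_splits)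
qed (rule duel_profile_mixed)

section \<open>Liquid welfare and the optimum\<close>

text \<open>Bidder 0 contributes at most the budget 1/2. Bidder 1 has \<open>c = 0\<close>, so the
  expected payment 1/(2V) bounds the expected value.\<close>

lemma liquid_welfare_duel_le:
  assumes V: "V \<ge> 1"
  shows "liquid_welfare (duel V) (duel_profile V) \<le> ennreal (1 / 2 + 1 / (2 * V))"
proof -
  have "expected_value (duel V) (Suc 0) ((duel_profile V)(Suc 0 := duel_profile V (Suc 0)))
      \<le> ennreal 0 + (\<integral>\<^sup>+b. ennreal (b 0) \<partial>duel_profile V (Suc 0))"
    by (rule expected_value_duel_profile(1)[OF V duel_profile_mixed]) simp_all
  then have "expected_value (duel V) (Suc 0) (duel_profile V) \<le> ennreal (1 / (2 * V))"
    using V nn_integral_ramp[OF V] by (simp only: fun_upd_triv) (simp add: duel_profile_def)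
  moreover have "budget (duel V) 0 = ennreal (1 / 2)"
    by (simp add: duel_def)
  moreover have "ennreal (1 / 2 + 1 / (2 * V)) = ennreal (1 / 2) + ennreal (1 / (2 * V))"
    using V by (intro ennreal_plus) auto
  ultimately show ?thesis
    by (simp add: liquid_welfare_def add_mono min.coboundedI1 min.coboundedI2)
qed

lemma opt_liquid_welfare_duel_ge:
  assumes V: "V \<ge> 1"
  shows "opt_liquid_welfare (duel V) \<ge> ennreal (3 / 2 - 1 / (2 * V))"
proof -
  define alloc :: "bool \<Rightarrow> nat \<Rightarrow> nat set" where
    "alloc = (\<lambda>b. \<lambda>i\<in>{0, 1}. if (i = 0) = b then {0} else {})"
  \<comment> \<open>With probability 1/(2V) bidder 0's expected value is exactly the budget 1/2, so
    the remaining probability goes to bidder 1.\<close>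
  define p where "p = map_pmf alloc (bernoulli_pmf (1 / (2 * V)))"
  have q: "0 \<le> 1 / (2 * V)" "1 / (2 * V) \<le> 1"
    using V by auto
  have "alloc b \<in> feasible_allocations (duel V)" for b
    by (auto simp: feasible_allocations_def alloc_def disjoint_family_on_def)
  then have p: "set_pmf p \<subseteq> feasible_allocations (duel V)"
    by (auto simp: p_def)
  have "(\<integral>\<^sup>+x. ennreal (valuation (duel V) 0 (x 0)) \<partial>measure_pmf p) = ennreal (1 / 2)"
    using V q by (simp add: p_def alloc_def duel_def flip: ennreal_mult)
  moreover have "(\<integral>\<^sup>+x. ennreal (valuation (duel V) 1 (x 1)) \<partial>measure_pmf p) = ennreal (1 - 1 / (2 * V))"
    using V q by (simp add: p_def alloc_def duel_def)
  ultimately have "(\<Sum>i\<in>bidders (duel V).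
      min (\<integral>\<^sup>+x. ennreal (valuation (duel V) i (x i)) \<partial>measure_pmf p) (budget (duel V) i))
      = ennreal (1 / 2) + ennreal (1 - 1 / (2 * V))"
    using q by (simp add: duel_def bidders_def min_absorb1 lessThan_nat_numeral flip: ennreal_1)
  also have "\<dots> = ennreal (3 / 2 - 1 / (2 * V))"
    using q by (subst ennreal_plus[symmetric]) simp_all
  finally show ?thesis
    unfolding opt_liquid_welfare_def using p by (intro SUP_upper2[of p]) auto
qed

theorem theorem4p8:
  "mixed_price_of_anarchy {I. xos_auction I} \<ge> 3"
\<comment> \<open>Each \<open>V\<close> only certifies a bound below 3, so the claim is shown up to
  an arbitrary \<open>e\<close>.\<close>
proof (rule ennreal_le_epsilon)
  fix e :: real assume "0 < e"
  \<comment> \<open>With this choice 4/(V + 1) = 4e/(2e + 4), which is at most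
    \<open>e\<close>.\<close>
  define V where "V = 1 + 4 / e"
  have V: "V \<ge> 1" and e: "4 / (V + 1) \<le> e"
    using \<open>0 < e\<close> by (auto simp: V_def field_simps)
  \<comment> \<open>The quotient of the two welfare bounds is (3V - 1)/(V + 1) = 3 - 4/(V +
    1).\<close>
  have "ennreal (3 - 4 / (V + 1)) = ennreal ((3 / 2 - 1 / (2 * V)) / (1 / 2 + 1 / (2 * V)))"
    using V by (simp add: divide_simps)
  also have "\<dots> = ennreal (3 / 2 - 1 / (2 * V)) / ennreal (1 / 2 + 1 / (2 * V))"
    using V by (intro divide_ennreal[symmetric]) (auto simp: field_simps add_pos_pos)
  also have "\<dots> \<le> opt_liquid_welfare (duel V) / liquid_welfare (duel V) (duel_profile V)"
    using opt_liquid_welfare_duel_ge[OF V] liquid_welfare_duel_le[OF V]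
    by (rule divide_mono_ennreal)
  also have "\<dots> \<le> mixed_price_of_anarchy {I. xos_auction I}"
    unfolding mixed_price_of_anarchy_def
    using xos_auction_duel[OF V] duel_profile_equilibrium[OF V]
    by (intro SUP_upper2[of "(duel V, duel_profile V)"]) auto
  finally have *: "ennreal (3 - 4 / (V + 1)) \<le> mixed_price_of_anarchy {I. xos_auction I}" .
  have "3 = ennreal 3" by simp
  also have "\<dots> \<le> ennreal ((3 - 4 / (V + 1)) + e)"
    using e by (intro ennreal_leI) simp
  also have "\<dots> = ennreal (3 - 4 / (V + 1)) + ennreal e"
    using V \<open>0 < e\<close> by (intro ennreal_plus) (auto simp: field_simps)
  also have "\<dots> \<le> mixed_price_of_anarchy {I. xos_auction I} + ennreal e"
    using * by (rule add_right_mono)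
  finally show "3 \<le> mixed_price_of_anarchy {I. xos_auction I} + ennreal e" .
qed

end
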